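(* Consider a single (packing) DRCCP under the type $\infty$-Wasserstein ambiguity set with affine mappings $a_1(x)=x$, $b_1(x)=b_1\ge0$ (a constant), deterministic set $\mathcal X\subseteq\{0,1\}^n$, and random parameters $\tilde\zeta=(\tilde\zeta_1,\dots,\tilde\zeta_n)$ whose components are i.i.d. and nonnegative. Then ALSO-X# is exact, i.e., $v^{A\#}=v^*$.
   Context: $c\in\mathbb{R}^n$, $\varepsilon\in(0,1)$, $\theta\ge0$, $(y)_+=\max\{y,0\}$. The reference distribution $\mathbb{P}_\zeta$ of $\tilde\zeta$ is assumed sub-Gaussian. The support set is $\Xi=\mathbb{R}^n_+$ and the norm is an $\ell_p$ norm $\|\cdot\|_p$ on $\mathbb{R}^n$ ($p\in[1,\infty]$). For $x\in\mathcal X$ and $\zeta\in\mathbb{R}^n_+$ put $$g(x,\zeta)=\max_{\xi\in\mathbb{R}^n_+}\Big\{\sum_{i=1}^n\xi_ix_i:\ \|\xi-\zeta\|_p\le\theta\Big\}-b_1 .$$ DRCCP (equivalent form of $\min_{x\in\mathcal X}\{c^\top x:\inf_{\mathbb{P}\in\mathcal P_\infty}\mathbb{P}\{x^\top\tilde\xi\le b_1\}\ge1-\varepsilon\}$): $v^*=\min\{c^\top x:x\in\mathcal X,\ \mathbb{P}_\zeta\{g(x,\tilde\zeta)\le0\}\ge1-\varepsilon\}$. ALSO-X#: $v^{A\#}$ is the minimum (infimum) of all $t$ for which there is $(x^*,\beta^* )\in\arg\min\{\varepsilon\beta+\mathbb{E}_{\mathbb{P}_\zeta}[(g(x,\tilde\zeta)-\beta)_+]:x\in\mathcal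 X,\ c^\top x\le t,\ \beta\le0\}$ with $\mathbb{P}_\zeta\{g(x^*,\tilde\zeta)\le0\}\ge1-\varepsilon$. A minimum or infimum over the empty set is $+\infty$. *)

theory Defs
  imports "HOL-Probability.Probability"
begin

definition lp_norm :: "ereal \<Rightarrow> real ^ 'n \<Rightarrow> real" where
  "lp_norm p x =
     (if p = \<infinity> then infnorm x
      else (\<Sum>i\<in>UNIV. \<bar>x $ i\<bar> powr real_of_ereal p) powr (1 / real_of_ereal p))"

definition nonneg_orthant :: "(real ^ 'n) set" where
  "nonneg_orthant = {\<xi>. \<forall>i. 0 \<le> \<xi> $ i}"

(* Tail characterisation of a sub-Gaussian distribution. Since all norms on real ^ 'n are
   equivalent, the choice of the norm only affects the constants. *)
definition sub_gaussian :: "(real ^ 'n) measure \<Rightarrow> bool" where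
  "sub_gaussian P \<longleftrightarrow>
     (\<exists>C1>0. \<exists>C2>0. \<forall>s\<ge>0.
        measure P {\<zeta> \<in> space P. norm \<zeta> \<ge> s} \<le> C1 * exp (- C2 * s\<^sup>2))"

definition iid_components :: "(real ^ 'n) measure \<Rightarrow> bool" where
  "iid_components P \<longleftrightarrow>
     prob_space.indep_vars P (\<lambda>_. borel) (\<lambda>i \<zeta>. \<zeta> $ i) UNIV \<and>
     (\<forall>i j. distr P borel (\<lambda>\<zeta>. \<zeta> $ i) = distr P borel (\<lambda>\<zeta>. \<zeta> $ j))"

(* For p \<ge> 1, \<theta> \<ge> 0 and \<zeta> in the nonnegative orthant, the index set is nonempty and compact, so
   the supremum is a maximum. Outside the orthant the value is irrelevant. *)
definition packing_g :: "ereal \<Rightarrow> real \<Rightarrow> real \<Rightarrow> real ^ 'n \<Rightarrow> real ^ 'n \<Rightarrow> real" where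
  "packing_g p \<theta> b\<^sub>1 x \<zeta> =
     (SUP \<xi>\<in>{\<xi> \<in> nonneg_orthant. lp_norm p (\<xi> - \<zeta>) \<le> \<theta>}. \<Sum>i\<in>UNIV. \<xi> $ i * x $ i) - b\<^sub>1"

definition chance_feasible ::
  "(real ^ 'n) measure \<Rightarrow> (real ^ 'n \<Rightarrow> real ^ 'n \<Rightarrow> real) \<Rightarrow> real \<Rightarrow> real ^ 'n \<Rightarrow> bool" where
  "chance_feasible P g \<epsilon> x \<longleftrightarrow> measure P {\<zeta> \<in> space P. g x \<zeta> \<le> 0} \<ge> 1 - \<epsilon>"

(* Optimal values live in ereal: the infimum of the empty set is \<infinity>. *)
definition drccp_value ::
  "real ^ 'n \<Rightarrow> (real ^ 'n) set \<Rightarrow> (real ^ 'n) measure \<Rightarrow> (real ^ 'n \<Rightarrow> real ^ 'n \<Rightarrow> real) \<Rightarrow> real \<Rightarrow> ereal"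
  where
  "drccp_value c X P g \<epsilon> = (INF x\<in>{x \<in> X. chance_feasible P g \<epsilon> x}. ereal (c \<bullet> x))"

definition also_x_sharp_objective ::
  "(real ^ 'n) measure \<Rightarrow> (real ^ 'n \<Rightarrow> real ^ 'n \<Rightarrow> real) \<Rightarrow> real \<Rightarrow> (real ^ 'n) \<times> real \<Rightarrow> real" where
  "also_x_sharp_objective P g \<epsilon> =
     (\<lambda>(x, \<beta>). \<epsilon> * \<beta> + (LINT \<zeta>|P. max (g x \<zeta> - \<beta>) 0))"

definition also_x_sharp_value ::
  "real ^ 'n \<Rightarrow> (real ^ 'n) set \<Rightarrow> (real ^ 'n) measure \<Rightarrow> (real ^ 'n \<Rightarrow> real ^ 'n \<Rightarrow> real) \<Rightarrow> real \<Rightarrow> ereal"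
  where
  "also_x_sharp_value c X P g \<epsilon> =
     (INF t\<in>{t. \<exists>x \<beta>.
           is_arg_min (also_x_sharp_objective P g \<epsilon>)
             (\<lambda>(x, \<beta>). x \<in> X \<and> c \<bullet> x \<le> t \<and> \<beta> \<le> 0) (x, \<beta>) \<and>
           chance_feasible P g \<epsilon> x}. ereal t)"

end

theory Submission
  imports Defs
begin

text \<open>
  ALSO-X# can never be better than the chance-constrained problem, since any \<open>t\<close> that it
  accepts comes with a feasible \<open>x\<close> satisfying \<open>c \<bullet> x \<le> t\<close>.  It could be worse only if, at the
  budget \<open>t = c \<bullet> y\<close> of some chance-feasible \<open>y\<close>, every minimizer of its objective violated the
  chance constraint.  The point is that for independent and identically distributed components the
  law of the constraint function at a binary \<open>x\<close> depends only on the number of selected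
  items, and grows stochastically with that number.  A decision with fewest selected items
  within the budget therefore does two things at once: it minimizes the objective for
  every \<open>\<beta>\<close>, and it is chance-feasible because \<open>y\<close> is.

  The dependence on the number of items only is a symmetry argument.  The norm, the orthant and the
  reference distribution are all invariant under permutations of the coordinates
  (\<open>distr_packing_g_permute\<close>), and if \<open>x\<close> selects at most as many items as \<open>y\<close>, some
  permutation of \<open>x\<close> lies componentwise below \<open>y\<close>, where monotonicity of the worst-case
  value applies (\<open>binary_support_comparison\<close>).  Laws of the worst-case
  value reduce to the law of \<open>\<zeta>\<close> because it equals \<open>x \<bullet> \<zeta>\<close> plus a constant
  (\<open>packing_g_affine\<close>).

  The sub-Gaussian tails make the expectation in the objective finite.  This
  matters for exactness, because the argmin must be nonempty: the minimum over \<open>\<beta> \<le> 0\<close> is attained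
  by continuity and coercivity (\<open>shortfall_attains_min\<close>).
\<close>

section \<open>Coordinate permutations and the worst-case value\<close>

definition permute_coords :: "('n \<Rightarrow> 'n) \<Rightarrow> real ^ 'n \<Rightarrow> real ^ 'n" where
  "permute_coords \<pi> x = (\<chi> i. x $ \<pi> i)"

lemma permute_coords_nth [simp]: "permute_coords \<pi> x $ i = x $ \<pi> i"
  by (simp add: permute_coords_def)

lemma permute_coords_zero [simp]: "permute_coords \<pi> 0 = 0"
  by (simp add: vec_eq_iff)

lemma inner_permute_coords:
  assumes "bij \<pi>"
  shows "permute_coords \<pi> x \<bullet> permute_coords \<pi> \<zeta> = x \<bullet> \<zeta>"
  unfolding inner_vec_def permute_coords_nth
  by (rule sum.reindex_bij_betw[OF assms, where g = "\<lambda>i. x $ i \<bullet> \<zeta> $ i"])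

lemma lp_norm_cong_permute:
  assumes "bij \<pi>" and abs: "\<And>i. \<bar>y $ i\<bar> = \<bar>x $ \<pi> i\<bar>"
  shows "lp_norm p y = lp_norm p x"
proof -
  have "(\<Sum>i\<in>UNIV. \<bar>x $ \<pi> i\<bar> powr real_of_ereal p) = (\<Sum>i\<in>UNIV. \<bar>x $ i\<bar> powr real_of_ereal p)"
    by (rule sum.reindex_bij_betw[OF assms(1)])
  moreover have "{\<bar>x $ \<pi> i\<bar> |i. i \<in> UNIV} = {\<bar>x $ i\<bar> |i. i \<in> UNIV}"
    using bij_is_surj[OF assms(1)] by (auto simp: surj_def) (metis surj_def)
  ultimately show ?thesis
    by (simp add: lp_norm_def infnorm_cart abs)
qed

lemma lp_norm_zero [simp]: "lp_norm p 0 = 0"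
  by (simp add: lp_norm_def infnorm_0)

lemma abs_component_le_lp_norm:
  assumes "1 \<le> p"
  shows "\<bar>x $ i\<bar> \<le> lp_norm p x"
proof (cases "p = \<infinity>")
  case True
  then show ?thesis by (simp add: lp_norm_def component_le_infnorm_cart)
next
  case False
  define r where "r = real_of_ereal p"
  have r: "r \<ge> 1"
    using assms False by (cases p) (auto simp: r_def)
  have "\<bar>x $ i\<bar> powr r \<le> (\<Sum>j\<in>UNIV. \<bar>x $ j\<bar> powr r)"
    by (rule member_le_sum) auto
  then have "(\<bar>x $ i\<bar> powr r) powr (1 / r) \<le> (\<Sum>j\<in>UNIV. \<bar>x $ j\<bar> powr r) powr (1 / r)"
    using r by (intro powr_mono2) auto
  moreover have "(\<bar>x $ i\<bar> powr r) powr (1 / r) = \<bar>x $ i\<bar>"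
    using r by (simp add: powr_powr)
  ultimately show ?thesis
    using False by (simp add: lp_norm_def r_def)
qed

lemma bdd_above_packing:
  assumes "1 \<le> p" and x: "\<And>i. 0 \<le> x $ i"
  shows "bdd_above ((\<lambda>\<xi>. \<Sum>i\<in>UNIV. \<xi> $ i * x $ i) ` {\<xi> \<in> nonneg_orthant. lp_norm p (\<xi> - \<zeta>) \<le> \<theta>})"
proof (rule bdd_aboveI2)
  fix \<xi> assume "\<xi> \<in> {\<xi> \<in> nonneg_orthant. lp_norm p (\<xi> - \<zeta>) \<le> \<theta>}"
  then have "\<xi> $ i \<le> \<zeta> $ i + \<theta>" for i
    using abs_component_le_lp_norm[OF assms(1), of "\<xi> - \<zeta>" i] by auto
  then show "(\<Sum>i\<in>UNIV. \<xi> $ i * x $ i) \<le> (\<Sum>i\<in>UNIV. (\<zeta> $ i + \<theta>) * x $ i)"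
    by (intro sum_mono mult_right_mono x)
qed

lemma packing_g_mono:
  assumes "1 \<le> p" "0 \<le> \<theta>" "\<zeta> \<in> nonneg_orthant"
    and x: "\<And>i. 0 \<le> x $ i" and xy: "\<And>i. x $ i \<le> y $ i"
  shows "packing_g p \<theta> b x \<zeta> \<le> packing_g p \<theta> b y \<zeta>"
proof -
  have "lp_norm p (\<zeta> - \<zeta>) \<le> \<theta>"
    using assms by simp
  then show ?thesis
    unfolding packing_g_def using assms order_trans[OF x xy]
    by (intro diff_right_mono cSUP_mono bdd_above_packing)
       (auto simp: nonneg_orthant_def intro!: sum_mono mult_left_mono)
qed

text \<open>
  Within the orthant the adversary gains nothing from decreasing a coordinate: replacing
  \<open>\<xi> - \<zeta>\<close> by its absolute value keeps the norm, stays in the orthant, and does not decrease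
  the objective.  The optimal perturbation is therefore the one available at \<open>\<zeta> = 0\<close>, so that
  \<open>packing_g\<close> is affine in \<open>\<zeta>\<close>.
\<close>

lemma packing_g_affine:
  fixes x \<zeta> :: "real ^ 'n"
  assumes p: "1 \<le> p" and "0 \<le> \<theta>" and \<zeta>: "\<zeta> \<in> nonneg_orthant" and x: "\<And>i. 0 \<le> x $ i"
  shows "packing_g p \<theta> b x \<zeta> = x \<bullet> \<zeta> + packing_g p \<theta> b x 0"
proof -
  let ?A = "\<lambda>\<zeta> :: real ^ 'n. {\<xi> \<in> nonneg_orthant. lp_norm p (\<xi> - \<zeta>) \<le> \<theta>}"
  let ?f = "\<lambda>\<xi>. \<Sum>i\<in>UNIV. \<xi> $ i * x $ i"
  have inner: "x \<bullet> \<zeta> = ?f \<zeta>" for \<zeta>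
    by (simp add: inner_vec_def mult.commute)
  have "\<zeta> \<in> ?A \<zeta>" "0 \<in> ?A 0"
    using \<zeta> \<open>0 \<le> \<theta>\<close> by (auto simp: nonneg_orthant_def)
  then have ne: "?A \<zeta> \<noteq> {}" "?A 0 \<noteq> {}"
    by blast+
  have "(SUP \<xi>\<in>?A \<zeta>. ?f \<xi>) \<le> x \<bullet> \<zeta> + (SUP \<xi>\<in>?A 0. ?f \<xi>)"
  proof (rule cSUP_least[OF ne(1)])
    fix \<xi> assume \<xi>: "\<xi> \<in> ?A \<zeta>"
    define \<delta> :: "real ^ 'n" where "\<delta> = (\<chi> i. \<bar>\<xi> $ i - \<zeta> $ i\<bar>)"
    have "lp_norm p \<delta> = lp_norm p (\<xi> - \<zeta>)"
      by (rule lp_norm_cong_permute[of id]) (auto simp: \<delta>_def)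
    then have "\<delta> \<in> ?A 0"
      using \<xi> by (simp add: nonneg_orthant_def \<delta>_def)
    then have "?f \<delta> \<le> (SUP \<xi>\<in>?A 0. ?f \<xi>)"
      by (rule cSUP_upper[OF _ bdd_above_packing[OF p x]])
    moreover have "?f \<xi> \<le> ?f \<zeta> + ?f \<delta>"
      unfolding sum.distrib[symmetric] distrib_right[symmetric]
      by (intro sum_mono mult_right_mono x) (simp add: \<delta>_def)
    ultimately show "?f \<xi> \<le> x \<bullet> \<zeta> + (SUP \<xi>\<in>?A 0. ?f \<xi>)"
      by (simp add: inner)
  qed
  moreover have "(SUP \<xi>\<in>?A 0. ?f \<xi>) \<le> (SUP \<xi>\<in>?A \<zeta>. ?f \<xi>) - x \<bullet> \<zeta>"
  proof (rule cSUP_least[OF ne(2)])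
    fix \<delta> assume "\<delta> \<in> ?A 0"
    then have "\<zeta> + \<delta> \<in> ?A \<zeta>"
      using \<zeta> by (simp add: nonneg_orthant_def)
    then have "?f (\<zeta> + \<delta>) \<le> (SUP \<xi>\<in>?A \<zeta>. ?f \<xi>)"
      by (rule cSUP_upper[OF _ bdd_above_packing[OF p x]])
    then show "?f \<delta> \<le> (SUP \<xi>\<in>?A \<zeta>. ?f \<xi>) - x \<bullet> \<zeta>"
      by (simp add: inner distrib_right sum.distrib)
  qed
  ultimately show ?thesis
    by (simp add: packing_g_def)
qed

lemma packing_g_permute_zero:
  assumes "bij \<pi>"
  shows "packing_g p \<theta> b (permute_coords \<pi> x) 0 = packing_g p \<theta> b x 0"
proof -
  let ?A = "{\<xi> \<in> nonneg_orthant. lp_norm p (\<xi> - 0) \<le> \<theta>}"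
  have "lp_norm p (permute_coords \<rho> \<xi>) = lp_norm p \<xi>" if "bij \<rho>" for \<rho> and \<xi> :: "real ^ 'a"
    by (rule lp_norm_cong_permute[OF that]) simp
  then have maps: "permute_coords \<rho> ` ?A \<subseteq> ?A" if "bij \<rho>" for \<rho> :: "'a \<Rightarrow> 'a"
    using that by (auto simp: nonneg_orthant_def)
  have "\<xi> \<in> permute_coords \<pi> ` ?A" if "\<xi> \<in> ?A" for \<xi>
  proof
    show "\<xi> = permute_coords \<pi> (permute_coords (inv \<pi>) \<xi>)"
      using assms by (simp add: vec_eq_iff bij_is_inj)
    show "permute_coords (inv \<pi>) \<xi> \<in> ?A"
      using maps[OF bij_imp_bij_inv[OF assms]] that by blast
  qed
  with maps[OF assms] have A: "?A = permute_coords \<pi> ` ?A"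
    by blast
  have "(\<lambda>\<xi>. \<Sum>i\<in>UNIV. \<xi> $ i * permute_coords \<pi> x $ i) ` ?A
      = (\<lambda>\<xi>. \<Sum>i\<in>UNIV. permute_coords \<pi> \<xi> $ i * permute_coords \<pi> x $ i) ` ?A"
    by (subst A) (simp add: image_image)
  also have "\<dots> = (\<lambda>\<xi>. \<Sum>i\<in>UNIV. \<xi> $ i * x $ i) ` ?A"
    using inner_permute_coords[OF assms, of _ x] by (simp add: inner_vec_def)
  finally show ?thesis
    by (simp add: packing_g_def)
qed

section \<open>Exchangeability\<close>

lemma space_orthant_sets:
  assumes "sets P = sets (restrict_space borel nonneg_orthant)"
  shows "space P = nonneg_orthant"
  using sets_eq_imp_space_eq[OF assms] by (simp add: space_restrict_space)

lemma borel_measurable_orthant_sets: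
  assumes "sets P = sets (restrict_space borel nonneg_orthant)" and "f \<in> borel_measurable borel"
  shows "f \<in> borel_measurable P"
  using measurable_restrict_space1[OF assms(2)] measurable_cong_sets[OF assms(1) refl] by blast

lemma borel_measurable_vec_nth: "(\<lambda>\<zeta> :: real ^ 'n. \<zeta> $ i) \<in> borel_measurable borel"
  by (intro borel_measurable_continuous_onI continuous_intros)

lemma measurable_vec_lambda:
  "(vec_lambda :: ('n::finite \<Rightarrow> real) \<Rightarrow> real ^ 'n) \<in> borel_measurable (\<Pi>\<^sub>M i\<in>UNIV. borel)"
  by (subst borel_measurable_euclidean_space) (auto simp: Basis_vec_def inner_axis)

lemma measurable_permute_coords:
  "(permute_coords \<pi> :: real ^ 'n \<Rightarrow> real ^ 'n) \<in> borel_measurable borel"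
  by (subst borel_measurable_euclidean_space)
     (auto simp: Basis_vec_def inner_axis borel_measurable_vec_nth)

text \<open>
  The law of the coordinate process is a power of one measure on the reals, and a
  power measure is invariant under reindexing by an injection.
\<close>

lemma distr_permute_coords:
  fixes P :: "(real ^ 'n) measure"
  assumes "prob_space P" and P: "sets P = sets (restrict_space borel nonneg_orthant)"
    and iid: "iid_components P" and \<pi>: "bij \<pi>"
  shows "distr P borel (permute_coords \<pi>) = distr P borel (\<lambda>\<zeta>. \<zeta>)"
proof -
  interpret prob_space P by fact
  let ?B = "\<Pi>\<^sub>M i\<in>(UNIV :: 'n set). (borel :: real measure)"
  note meas = borel_measurable_orthant_sets[OF P]
  have nth: "(\<lambda>\<zeta>. \<zeta> $ i) \<in> borel_measurable P" for i
    by (rule meas[OF borel_measurable_vec_nth])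
  have joint: "vec_nth \<in> measurable P ?B"
    using measurable_PiM_single'[of UNIV "\<lambda>i \<zeta>. \<zeta> $ i" P "\<lambda>_. borel"] nth by simp
  define D where "D = distr P borel (\<lambda>\<zeta>. \<zeta> $ (SOME i. True))"
  have D: "distr P borel (\<lambda>\<zeta>. \<zeta> $ i) = D" for i
    using iid by (auto simp: iid_components_def D_def)
  have "prob_space D"
    unfolding D_def by (rule prob_space_distr[OF nth])
  have "distr P ?B vec_nth = (\<Pi>\<^sub>M i\<in>UNIV. D)"
    using iid indep_vars_iff_distr_eq_PiM[of "UNIV :: 'n set" "\<lambda>i \<zeta>. \<zeta> $ i" "\<lambda>_. borel"] nth
    by (simp add: iid_components_def D restrict_def)
  moreover have "distr (\<Pi>\<^sub>M i\<in>UNIV. D) (\<Pi>\<^sub>M i\<in>UNIV. D) (\<lambda>\<omega> n. \<omega> (\<pi> n)) = (\<Pi>\<^sub>M i\<in>UNIV. D)"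
    using distr_PiM_reindex[of UNIV "\<lambda>_. D" \<pi> UNIV] \<open>prob_space D\<close> bij_is_inj[OF \<pi>] by (simp add: restrict_def)
  moreover have "sets (\<Pi>\<^sub>M i\<in>UNIV. D) = sets ?B"
    by (intro sets_PiM_cong) (simp_all add: D_def)
  ultimately have eq: "distr (distr P ?B vec_nth) ?B (\<lambda>\<omega> n. \<omega> (\<pi> n)) = distr P ?B vec_nth"
    by (metis distr_cong)
  have re: "(\<lambda>\<omega> n. \<omega> (\<pi> n)) \<in> measurable ?B ?B"
    using measurable_PiM_single'[of UNIV "\<lambda>n \<omega>. \<omega> (\<pi> n)" ?B "\<lambda>_. borel"]
    by (simp add: space_PiM)
  have "distr P borel (permute_coords \<pi>)
      = distr (distr (distr P ?B vec_nth) ?B (\<lambda>\<omega> n. \<omega> (\<pi> n))) borel vec_lambda"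
    unfolding distr_distr[OF re joint] distr_distr[OF measurable_vec_lambda measurable_comp[OF joint re]]
    by (simp add: comp_def permute_coords_def[abs_def])
  also have "\<dots> = distr P borel (\<lambda>\<zeta>. \<zeta>)"
    unfolding eq distr_distr[OF measurable_vec_lambda joint] by (simp add: comp_def)
  finally show ?thesis .
qed

text \<open>
  Permuting \<open>x\<close> and \<open>\<zeta>\<close> together leaves the worst-case value unchanged, and permuting
  \<open>\<zeta>\<close> alone leaves the reference distribution unchanged.
\<close>

lemma distr_packing_g_permute:
  fixes P :: "(real ^ 'n) measure"
  assumes "prob_space P" and P: "sets P = sets (restrict_space borel nonneg_orthant)"
    and iid: "iid_components P" and \<pi>: "bij \<pi>"
    and p: "1 \<le> p" "0 \<le> \<theta>" and x: "\<And>i. 0 \<le> x $ i"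
  shows "distr P borel (packing_g p \<theta> b (permute_coords \<pi> x)) = distr P borel (packing_g p \<theta> b x)"
proof -
  let ?h = "\<lambda>x \<zeta>. x \<bullet> \<zeta> + packing_g p \<theta> b x 0"
  have affine: "distr P borel (packing_g p \<theta> b y) = distr P borel (?h y)" if "\<And>i. 0 \<le> y $ i" for y
    using packing_g_affine[OF p _ that] space_orthant_sets[OF P] by (intro distr_cong) auto
  have h: "?h y \<in> borel_measurable borel" for y
    by (intro borel_measurable_continuous_onI continuous_intros)
  note id = borel_measurable_orthant_sets[OF P measurable_ident[unfolded id_def]]
  note perm = borel_measurable_orthant_sets[OF P measurable_permute_coords]
  have "distr P borel (?h (permute_coords \<pi> x))
      = distr (distr P borel (permute_coords \<pi>)) borel (?h (permute_coords \<pi> x))"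
    using distr_distr[OF h id] distr_permute_coords[OF assms(1) P iid \<pi>] by (simp add: comp_def)
  also have "\<dots> = distr P borel (?h x)"
    using distr_distr[OF h perm, of \<pi> "permute_coords \<pi> x"]
    by (simp add: comp_def inner_permute_coords[OF \<pi>] packing_g_permute_zero[OF \<pi>])
  finally show ?thesis
    using affine[of x] affine[of "permute_coords \<pi> x"] x by simp
qed

section \<open>Integrability\<close>

text \<open>
  The expected norm is at most the sum over \<open>n\<close> of the probabilities that the norm exceeds \<open>n\<close>,
  and \<open>n\<^sup>2 \<ge> n\<close> bounds the Gaussian tails by a geometric series.
\<close>

lemma integrable_norm_sub_gaussian:
  fixes P :: "(real ^ 'n) measure"
  assumes "prob_space P" and P: "sets P = sets (restrict_space borel nonneg_orthant)"
    and "sub_gaussian P"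
  shows "integrable P norm"
proof -
  interpret prob_space P by fact
  obtain C1 C2 where C: "C1 > 0" "C2 > 0"
    and tail: "\<And>s. s \<ge> 0 \<Longrightarrow> measure P {\<zeta> \<in> space P. norm \<zeta> \<ge> s} \<le> C1 * exp (- C2 * s\<^sup>2)"
    using assms(3) unfolding sub_gaussian_def by blast
  have norm [measurable]: "norm \<in> borel_measurable P"
    by (rule borel_measurable_orthant_sets[OF P borel_measurable_norm])
  define N where "N = (\<lambda>\<zeta> :: real ^ 'n. nat \<lceil>norm \<zeta>\<rceil>)"
  have N [measurable]: "N \<in> measurable P (count_space UNIV)"
    unfolding N_def by measurable
  have "(\<integral>\<^sup>+\<zeta>. ennreal (norm \<zeta>) \<partial>P) \<le> (\<integral>\<^sup>+\<zeta>. of_nat (N \<zeta>) \<partial>P)"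
  proof (rule nn_integral_mono)
    fix \<zeta> :: "real ^ 'n"
    have "ennreal (norm \<zeta>) \<le> ennreal (real (N \<zeta>))"
      unfolding N_def by (intro ennreal_leI real_nat_ceiling_ge)
    then show "ennreal (norm \<zeta>) \<le> of_nat (N \<zeta>)"
      by (simp add: ennreal_of_nat_eq_real_of_nat)
  qed
  also have "\<dots> = (\<Sum>t. emeasure P {\<zeta> \<in> space P. t < N \<zeta>})"
    by (rule nn_integral_nat_function[OF N])
  also have "\<dots> \<le> (\<Sum>t. ennreal (C1 * exp (- C2) ^ t))"
  proof (rule suminf_le)
    fix t :: nat
    have "measure P {\<zeta> \<in> space P. t < N \<zeta>} \<le> measure P {\<zeta> \<in> space P. norm \<zeta> \<ge> real t}"
    proof (rule finite_measure_mono)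
      show "{\<zeta> \<in> space P. t < N \<zeta>} \<subseteq> {\<zeta> \<in> space P. norm \<zeta> \<ge> real t}"
        unfolding N_def by (auto simp: less_ceiling_iff zless_nat_eq_int_zless)
    qed measurable
    also have "\<dots> \<le> C1 * exp (- C2 * (real t)\<^sup>2)"
      by (rule tail) simp
    also have "\<dots> \<le> C1 * exp (- C2) ^ t"
    proof -
      have "real t \<le> (real t)\<^sup>2"
        by (cases t) (auto simp: power2_eq_square)
      then have "- C2 * (real t)\<^sup>2 \<le> real t * - C2"
        using C by (simp add: mult.commute)
      then have "exp (- C2 * (real t)\<^sup>2) \<le> exp (real t * - C2)"
        by (subst exp_le_cancel_iff)
      then show ?thesis
        using C by (simp only: exp_of_nat_mult mult_le_cancel_left_pos)
    qed
    finally show "emeasure P {\<zeta> \<in> space P. t < N \<zeta>} \<le> ennreal (C1 * exp (- C2) ^ t)"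
      using C by (simp add: emeasure_eq_measure ennreal_leI)
  qed auto
  also have "\<dots> < \<infinity>"
  proof -
    have "summable (\<lambda>t. C1 * exp (- C2) ^ t)"
      using C by (intro summable_mult summable_geometric) simp
    then show ?thesis
      using C by (subst suminf_ennreal2) auto
  qed
  finally show ?thesis
    by (intro integrableI_bounded) auto
qed

lemma integrable_packing_g:
  fixes P :: "(real ^ 'n) measure"
  assumes "prob_space P" and P: "sets P = sets (restrict_space borel nonneg_orthant)"
    and "sub_gaussian P" and p: "1 \<le> p" "0 \<le> \<theta>" and x: "\<And>i. 0 \<le> x $ i"
  shows "integrable P (packing_g p \<theta> b x)"
proof -
  interpret prob_space P by fact
  have meas: "(\<lambda>\<zeta>. x \<bullet> \<zeta>) \<in> borel_measurable P"
    by (intro borel_measurable_orthant_sets[OF P] borel_measurable_continuous_onI continuous_intros)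
  have bound: "\<forall>\<zeta>. norm (x \<bullet> \<zeta>) \<le> norm (norm x * norm \<zeta>)"
    by (simp add: Cauchy_Schwarz_ineq2)
  have "integrable P (\<lambda>\<zeta>. norm x * norm \<zeta>)"
    using integrable_norm_sub_gaussian[OF assms(1-3)] by simp
  then have "integrable P (\<lambda>\<zeta>. x \<bullet> \<zeta>)"
    by (rule Bochner_Integration.integrable_bound[OF _ meas always_eventually[OF bound]])
  then have "integrable P (\<lambda>\<zeta>. x \<bullet> \<zeta> + packing_g p \<theta> b x 0)"
    by simp
  then show ?thesis
    using packing_g_affine[OF p _ x] space_orthant_sets[OF P]
    by (subst Bochner_Integration.integrable_cong[OF refl]) auto
qed

section \<open>The ALSO-X# objective\<close>

text \<open>
  The objective is continuous in \<open>\<beta>\<close>, and it is at least \<open>(\<epsilon> - 1) * \<beta> + E G\<close>, which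
  tends to infinity as \<open>\<beta>\<close> decreases because \<open>\<epsilon> < 1\<close>.
\<close>

lemma shortfall_attains_min:
  fixes G :: "'a \<Rightarrow> real"
  assumes "prob_space P" and G: "integrable P G" and \<epsilon>: "\<epsilon> < 1"
  obtains \<beta> where "\<beta> \<le> 0"
    and "\<And>\<gamma>. \<gamma> \<le> 0 \<Longrightarrow> \<epsilon> * \<beta> + (LINT \<zeta>|P. max (G \<zeta> - \<beta>) 0) \<le> \<epsilon> * \<gamma> + (LINT \<zeta>|P. max (G \<zeta> - \<gamma>) 0)"
proof -
  interpret prob_space P by fact
  define \<phi> where "\<phi> \<beta> = \<epsilon> * \<beta> + (LINT \<zeta>|P. max (G \<zeta> - \<beta>) 0)" for \<beta>
  have int: "integrable P (\<lambda>\<zeta>. max (G \<zeta> - \<beta>) 0)" for \<beta>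
    using G by (intro integrable_max) auto
  have one_sided: "(LINT \<zeta>|P. max (G \<zeta> - \<beta>) 0) - (LINT \<zeta>|P. max (G \<zeta> - \<gamma>) 0) \<le> \<bar>\<beta> - \<gamma>\<bar>" for \<beta> \<gamma>
  proof -
    have "(LINT \<zeta>|P. max (G \<zeta> - \<beta>) 0) \<le> (LINT \<zeta>|P. max (G \<zeta> - \<gamma>) 0 + \<bar>\<beta> - \<gamma>\<bar>)"
      using int by (intro integral_mono) auto
    then show ?thesis
      using int[of \<gamma>] by (simp add: prob_space)
  qed
  have "1-lipschitz_on UNIV (\<lambda>\<beta>. LINT \<zeta>|P. max (G \<zeta> - \<beta>) 0)"
  proof (rule lipschitz_onI)
    fix \<beta> \<gamma> :: real
    show "dist (LINT \<zeta>|P. max (G \<zeta> - \<beta>) 0) (LINT \<zeta>|P. max (G \<zeta> - \<gamma>) 0) \<le> 1 * dist \<beta> \<gamma>"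
      using one_sided[of \<beta> \<gamma>] one_sided[of \<gamma> \<beta>] by (auto simp: dist_real_def)
  qed simp
  then have "continuous_on UNIV (\<lambda>\<beta>. LINT \<zeta>|P. max (G \<zeta> - \<beta>) 0)"
    by (rule lipschitz_on_continuous_on)
  then have cont: "continuous_on UNIV \<phi>"
    unfolding \<phi>_def by (intro continuous_intros)
  have lower: "expectation G - (1 - \<epsilon>) * \<beta> \<le> \<phi> \<beta>" for \<beta>
  proof -
    have "(LINT \<zeta>|P. G \<zeta> - \<beta>) \<le> (LINT \<zeta>|P. max (G \<zeta> - \<beta>) 0)"
      using int G by (intro integral_mono) auto
    then show ?thesis
      using G by (simp add: \<phi>_def prob_space algebra_simps)
  qed
  (* Below L the lower bound already exceeds the value at 0. *)
  define L where "L = (expectation G - \<phi> 0) / (1 - \<epsilon>)"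
  have "L \<le> 0"
    using lower[of 0] \<epsilon> by (auto simp: L_def divide_le_0_iff)
  then obtain \<beta> where \<beta>: "\<beta> \<in> {L..0}" "\<And>\<gamma>. \<gamma> \<in> {L..0} \<Longrightarrow> \<phi> \<beta> \<le> \<phi> \<gamma>"
    using continuous_attains_inf[of "{L..0}" \<phi>] continuous_on_subset[OF cont] by auto
  have "\<phi> \<beta> \<le> \<phi> \<gamma>" if "\<gamma> \<le> 0" for \<gamma>
  proof (cases "L \<le> \<gamma>")
    case True
    then show ?thesis using \<beta>(2) that by simp
  next
    case False
    have "\<phi> \<beta> \<le> \<phi> 0"
      using \<beta>(2) \<open>L \<le> 0\<close> by simp
    also have "\<phi> 0 = expectation G - (1 - \<epsilon>) * L"
      using \<epsilon> by (simp add: L_def)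
    also have "\<dots> \<le> expectation G - (1 - \<epsilon>) * \<gamma>"
      using False \<epsilon> by simp
    also have "\<dots> \<le> \<phi> \<gamma>"
      by (rule lower)
    finally show ?thesis .
  qed
  with \<beta>(1) show ?thesis
    by (intro that[of \<beta>]) (auto simp: \<phi>_def)
qed

lemma objective_cong_distr:
  assumes g: "g x \<in> borel_measurable P" "g y \<in> borel_measurable P"
    and law: "distr P borel (g x) = distr P borel (g y)"
  shows "also_x_sharp_objective P g \<epsilon> (x, \<beta>) = also_x_sharp_objective P g \<epsilon> (y, \<beta>)"
proof -
  have "(LINT r|distr P borel (g z). max (r - \<beta>) 0) = (LINT \<zeta>|P. max (g z \<zeta> - \<beta>) 0)"
    if "g z \<in> borel_measurable P" for z
    using that by (intro integral_distr) auto
  from this[of x] this[of y] show ?thesis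
    using g law by (simp add: also_x_sharp_objective_def)
qed

lemma chance_feasible_cong_distr:
  assumes g: "g x \<in> borel_measurable P" "g y \<in> borel_measurable P"
    and law: "distr P borel (g x) = distr P borel (g y)"
  shows "chance_feasible P g \<epsilon> x \<longleftrightarrow> chance_feasible P g \<epsilon> y"
proof -
  have "measure (distr P borel (g z)) {..0} = measure P {\<zeta> \<in> space P. g z \<zeta> \<le> 0}"
    if "g z \<in> borel_measurable P" for z
    using that by (subst measure_distr) (auto intro!: arg_cong[where f = "measure P"])
  from this[of x] this[of y] show ?thesis
    using g law by (simp add: chance_feasible_def)
qed

lemma objective_mono:
  assumes "prob_space P" "integrable P (g x)" "integrable P (g y)"
    and "\<And>\<zeta>. \<zeta> \<in> space P \<Longrightarrow> g x \<zeta> \<le> g y \<zeta>"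
  shows "also_x_sharp_objective P g \<epsilon> (x, \<beta>) \<le> also_x_sharp_objective P g \<epsilon> (y, \<beta>)"
proof -
  interpret prob_space P by fact
  have "(LINT \<zeta>|P. max (g x \<zeta> - \<beta>) 0) \<le> (LINT \<zeta>|P. max (g y \<zeta> - \<beta>) 0)"
    using assms(2-4) by (intro integral_mono integrable_max max.mono) auto
  then show ?thesis
    by (simp add: also_x_sharp_objective_def)
qed

lemma chance_feasible_antimono:
  assumes "prob_space P" and g: "g x \<in> borel_measurable P"
    and le: "\<And>\<zeta>. \<zeta> \<in> space P \<Longrightarrow> g x \<zeta> \<le> g y \<zeta>"
    and "chance_feasible P g \<epsilon> y"
  shows "chance_feasible P g \<epsilon> x"
proof -
  interpret prob_space P by fact
  have "measure P {\<zeta> \<in> space P. g y \<zeta> \<le> 0} \<le> measure P {\<zeta> \<in> space P. g x \<zeta> \<le> 0}"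
    using g by (intro finite_measure_mono) (auto dest: le)
  then show ?thesis
    using assms(4) by (simp add: chance_feasible_def)
qed

section \<open>Comparing binary decisions by the size of their support\<close>

lemma ex_bij_maps_into:
  fixes A B :: "'n::finite set"
  assumes "card A \<le> card B"
  obtains \<pi> :: "'n \<Rightarrow> 'n" where "bij \<pi>" "\<pi> ` A \<subseteq> B"
proof -
  obtain f where f: "f ` A \<subseteq> B" "inj_on f A"
    using card_le_inj[OF _ _ assms] by auto
  have "card (- S) + card S = CARD('n)" for S :: "'n set"
    using card_Un_disjoint[of "- S" S] by (simp add: Compl_partition2)
  from this[of A] this[of "f ` A"] have "card (- A) = card (- f ` A)"
    using card_image[OF f(2)] by linarith
  then obtain h where h: "bij_betw h (- A) (- f ` A)"
    using finite_same_card_bij[of "- A" "- f ` A"] by auto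
  have "bij_betw (\<lambda>i. if i \<in> A then f i else h i) (A \<union> - A) (f ` A \<union> - f ` A)"
    using bij_betw_disjoint_Un[OF inj_on_imp_bij_betw[OF f(2)] h] by auto
  then show ?thesis
    using f(1) by (intro that[of "\<lambda>i. if i \<in> A then f i else h i"]) auto
qed

text \<open>
  A decision with no more items than another can be moved below it by permuting its
  coordinates, and the permutation changes neither the objective nor the
  probability of feasibility.
\<close>

lemma binary_support_comparison:
  fixes P :: "(real ^ 'n) measure"
  assumes "prob_space P" and P: "sets P = sets (restrict_space borel nonneg_orthant)"
    and "sub_gaussian P" and iid: "iid_components P" and p: "1 \<le> p" "0 \<le> \<theta>"
    and x: "\<And>i. x $ i \<in> {0, 1}" and y: "\<And>i. y $ i \<in> {0, 1}"
    and card: "card {i. x $ i = 1} \<le> card {i. y $ i = 1}"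
  shows "also_x_sharp_objective P (packing_g p \<theta> b) \<epsilon> (x, \<beta>)
      \<le> also_x_sharp_objective P (packing_g p \<theta> b) \<epsilon> (y, \<beta>)" (is ?objective)
    and "chance_feasible P (packing_g p \<theta> b) \<epsilon> y \<Longrightarrow> chance_feasible P (packing_g p \<theta> b) \<epsilon> x"
      (is "PROP ?feasible")
proof -
  let ?g = "packing_g p \<theta> b"
  (* Coordinate i of the permuted x is x at \<pi> i, so it is the inverse of \<pi> that moves the
     support of x into that of y. *)
  obtain \<rho> :: "'n \<Rightarrow> 'n" where \<rho>: "bij \<rho>" "\<rho> ` {i. x $ i = 1} \<subseteq> {i. y $ i = 1}"
    using ex_bij_maps_into[OF card] by blast
  define z where "z = permute_coords (inv \<rho>) x"
  have nonneg: "0 \<le> x $ i" "0 \<le> y $ i" "0 \<le> z $ i" for i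
    using x[of i] y[of i] x[of "inv \<rho> i"] by (auto simp: z_def)
  have zy: "z $ i \<le> y $ i" for i
  proof (cases "x $ inv \<rho> i = 1")
    case True
    then have "y $ \<rho> (inv \<rho> i) = 1"
      using \<rho>(2) by blast
    then have "y $ i = 1"
      using \<rho>(1) by (simp add: bij_is_surj surj_f_inv_f)
    then show ?thesis
      using True by (simp add: z_def)
  next
    case False
    then show ?thesis
      using x[of "inv \<rho> i"] nonneg(2)[of i] by (simp add: z_def)
  qed
  note int = integrable_packing_g[OF assms(1) P assms(3) p, of _ b]
  have meas: "?g x \<in> borel_measurable P" "?g z \<in> borel_measurable P"
    using int[of x] int[of z] nonneg by auto
  have law: "distr P borel (?g z) = distr P borel (?g x)"
    unfolding z_def
    by (rule distr_packing_g_permute[OF assms(1) P iid bij_imp_bij_inv[OF \<rho>(1)] p nonneg(1)])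
  have le: "?g z \<zeta> \<le> ?g y \<zeta>" if "\<zeta> \<in> space P" for \<zeta>
    using that space_orthant_sets[OF P] by (intro packing_g_mono p nonneg zy) auto
  have "also_x_sharp_objective P ?g \<epsilon> (z, \<beta>) \<le> also_x_sharp_objective P ?g \<epsilon> (y, \<beta>)"
    by (rule objective_mono[of P ?g z y, OF assms(1) int int le]) (use nonneg in auto)
  then show ?objective
    using objective_cong_distr[of ?g z P x, OF meas(2) meas(1) law] by simp
  show "PROP ?feasible"
  proof -
    assume "chance_feasible P ?g \<epsilon> y"
    then have "chance_feasible P ?g \<epsilon> z"
      using chance_feasible_antimono[of P ?g z y, OF assms(1) meas(2)] le by blast
    then show "chance_feasible P ?g \<epsilon> x"
      using chance_feasible_cong_distr[of ?g z P x, OF meas(2) meas(1) law] by simp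
  qed
qed

section \<open>Exactness\<close>

lemma drccp_value_le_also_x_sharp_value:
  "drccp_value c X P g \<epsilon> \<le> also_x_sharp_value c X P g \<epsilon>"
  unfolding drccp_value_def also_x_sharp_value_def
  by (intro INF_mono) (auto simp: is_arg_min_def)

theorem corollary6:
  fixes c :: "real ^ 'n"
    and X :: "(real ^ 'n) set"
    and P :: "(real ^ 'n) measure"
    and p :: ereal
    and \<epsilon> \<theta> b\<^sub>1 :: real
  assumes "0 < \<epsilon>" and "\<epsilon> < 1"
    and "\<theta> \<ge> 0"
    and "b\<^sub>1 \<ge> 0"
    and "1 \<le> p"
    and "X \<subseteq> {x. \<forall>i. x $ i \<in> {0, 1}}"
    and "prob_space P"
    and "sets P = sets (restrict_space borel nonneg_orthant)"
    and "sub_gaussian P"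
    and "iid_components P"
  shows "also_x_sharp_value c X P (packing_g p \<theta> b\<^sub>1) \<epsilon> = drccp_value c X P (packing_g p \<theta> b\<^sub>1) \<epsilon>"
proof (rule antisym[OF _ drccp_value_le_also_x_sharp_value])
  let ?g = "packing_g p \<theta> b\<^sub>1"
  let ?obj = "also_x_sharp_objective P ?g \<epsilon>"
  let ?k = "\<lambda>x :: real ^ 'n. card {i. x $ i = 1}"
  have bin: "x $ i \<in> {0, 1}" if "x \<in> X" for x i
    using that assms(6) by auto
  note comparison = binary_support_comparison[OF assms(7-10,5,3) bin bin]
  show "also_x_sharp_value c X P ?g \<epsilon> \<le> drccp_value c X P ?g \<epsilon>"
    unfolding drccp_value_def
  proof (rule INF_greatest)
    fix y assume "y \<in> {x \<in> X. chance_feasible P ?g \<epsilon> x}"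
    then have y: "y \<in> X" "chance_feasible P ?g \<epsilon> y"
      by auto
    define t where "t = c \<bullet> y"
    (* With fewest selected items, x is stochastically smallest within the budget. *)
    obtain x where x: "x \<in> X" "c \<bullet> x \<le> t"
      and least: "\<And>z. z \<in> X \<Longrightarrow> c \<bullet> z \<le> t \<Longrightarrow> ?k x \<le> ?k z"
      using ex_has_least_nat[of "\<lambda>z. z \<in> X \<and> c \<bullet> z \<le> t" y ?k] y(1) by (auto simp: t_def)
    have "integrable P (?g x)"
      using bin[OF x(1)] by (intro integrable_packing_g assms) (metis insertE order_refl singletonD zero_le_one)
    then obtain \<beta> where \<beta>: "\<beta> \<le> 0" "\<And>\<gamma>. \<gamma> \<le> 0 \<Longrightarrow> ?obj (x, \<beta>) \<le> ?obj (x, \<gamma>)"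
      using shortfall_attains_min[OF assms(7) _ assms(2)]
      unfolding also_x_sharp_objective_def by auto
    have "?obj (x, \<beta>) \<le> ?obj (z, \<gamma>)" if "z \<in> X" "c \<bullet> z \<le> t" "\<gamma> \<le> 0" for z \<gamma>
      using order_trans[OF \<beta>(2) comparison(1)] x(1) least that by blast
    then have "is_arg_min ?obj (\<lambda>(x, \<beta>). x \<in> X \<and> c \<bullet> x \<le> t \<and> \<beta> \<le> 0) (x, \<beta>)"
      using x \<beta>(1) by (auto simp: is_arg_min_linorder)
    moreover have "chance_feasible P ?g \<epsilon> x"
      using comparison(2)[OF x(1) y(1) least y(2)] y(1) by (simp add: t_def)
    ultimately show "also_x_sharp_value c X P ?g \<epsilon> \<le> ereal (c \<bullet> y)"
      unfolding also_x_sharp_value_def t_def[symmetric] by (intro INF_lower) auto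
  qed
qed

end
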